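(* Let $(X,f_{1,\infty})$ be a non-autonomous discrete system with $f_{1,\infty}$ feeble open and surjective and converging uniformly to a map $f$, and suppose that $\{f_n^{n+k}\}_{k\in\mathbb{N}}$ converges collectively to $\{f^k\}_{k\in\mathbb{N}}$. If $f_{1,\infty}$ is multi-sensitive, then $f_{1,\infty}$ is thickly sensitive; and if $f_{1,\infty}$ is thickly sensitive and transitive, then $f_{1,\infty}$ is multi-sensitive.
   Context: $\mathbb{N}=\{1,2,3,\dots\}$. A non-autonomous discrete system $(X,f_{1,\infty})$ consists of a compact metric space $(X,d)$ and a sequence $f_{1,\infty}=\{f_n\}_{n=1}^\infty$ of continuous maps $f_n:X\to X$. For $i,n\in\mathbb{N}$, $f_i^n:=f_{i+(n-1)}\circ\cdots\circ f_i$ (a composition of $n$ maps), and $f_i^0=id_X$. Uniform convergence of $f_{1,\infty}$ to $f:X\to X$ means $D(f_n,f)\to 0$, where $D(g,h)=\sup_{x\in X}d(g(x),h(x))$. "$\{f_n^{n+k}\}_{k\in\mathbb{N}}$ converges collectively to $\{f^k\}_{k\in\mathbb{N}}$" means: for every $\varepsilon>0$ there exists $r_0\in\mathbb{N}$ such that $D(f_r^k,f^k)<\varepsilon$ for all $r\ge r_0$ and all $k\in\mathbb{N}$, where $f_r^k=f_{r+k-1}\circ\cdots\circ f_r$ and $f^k$ is the $k$-fold composition of $f$. $f_{1,\infty}$ is surjective if every $f_i$ is surjective. It is feeble open if $\mathrm{int}(f_i(U))\neq\emptyset$ for every nonempty open $U\subseteq X$ and every $i\in\mathbb{N}$. The system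 is transitive if for any two nonempty open subsets $U,V\subseteq X$ there exists $n\in\mathbb{N}$ such that $f_1^n(U)\cap V\neq\emptyset$. For $U\subseteq X$ nonempty open and $\delta>0$, let $N_{f_{1,\infty}}(U,\delta)=\{n\in\mathbb{N}: \text{there exist } x,y\in U \text{ with } d(f_1^n(x),f_1^n(y))>\delta\}$. A set $A\subseteq\mathbb{N}$ is thick if for every $p\in\mathbb{N}$ there is $n\in\mathbb{N}$ with $\{n,n+1,\dots,n+p\}\subseteq A$. The system is thickly sensitive if there exists $\delta>0$ such that $N_{f_{1,\infty}}(U,\delta)$ is thick for every nonempty open $U\subseteq X$. It is multi-sensitive if there exists $\delta>0$ such that for every $m\in\mathbb{N}$ and all nonempty open sets $U_1,\dots,U_m\subseteq X$, $\bigcap_{i=1}^m N_{f_{1,\infty}}(U_i,\delta)\neq\emptyset$. *)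

theory Defs
  imports "HOL-Analysis.Analysis"
begin

text \<open>
  The space is a type \<open>'a :: metric_space\<close> whose universe is compact. Sequences of maps
  are functions on \<open>nat\<close> that are only ever inspected at indices \<open>\<ge> 1\<close>; the value
  at \<open>0\<close> is irrelevant.
\<close>

definition nads :: "(nat \<Rightarrow> 'a::metric_space \<Rightarrow> 'a) \<Rightarrow> bool" where
  "nads f \<longleftrightarrow> compact (UNIV :: 'a set) \<and> (\<forall>n\<ge>1. continuous_on UNIV (f n))"

text \<open>\<open>iter_from f i n\<close> is $f_i^n = f_{i+n-1} \circ \cdots \circ f_i$: the superscript counts
  the maps in the composition.\<close>

fun iter_from :: "(nat \<Rightarrow> 'a \<Rightarrow> 'a) \<Rightarrow> nat \<Rightarrow> nat \<Rightarrow> 'a \<Rightarrow> 'a" where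
  "iter_from f i 0 = id"
| "iter_from f i (Suc n) = f (i + n) \<circ> iter_from f i n"

text \<open>On a compact space the set of distances is bounded, so the real supremum is the true one.\<close>

definition sup_dist :: "('a::metric_space \<Rightarrow> 'a) \<Rightarrow> ('a \<Rightarrow> 'a) \<Rightarrow> real" where
  "sup_dist g h = (SUP x. dist (g x) (h x))"

definition converges_uniformly ::
  "(nat \<Rightarrow> 'a::metric_space \<Rightarrow> 'a) \<Rightarrow> ('a \<Rightarrow> 'a) \<Rightarrow> bool" where
  "converges_uniformly f g \<longleftrightarrow> (\<lambda>n. sup_dist (f n) g) \<longlonglongrightarrow> 0"

definition converges_collectively ::
  "(nat \<Rightarrow> 'a::metric_space \<Rightarrow> 'a) \<Rightarrow> ('a \<Rightarrow> 'a) \<Rightarrow> bool" where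
  "converges_collectively f g \<longleftrightarrow>
     (\<forall>\<epsilon>>0. \<exists>r0\<ge>1. \<forall>r\<ge>r0. \<forall>k\<ge>1. sup_dist (iter_from f r k) (g ^^ k) < \<epsilon>)"

definition surjective_seq :: "(nat \<Rightarrow> 'a \<Rightarrow> 'a) \<Rightarrow> bool" where
  "surjective_seq f \<longleftrightarrow> (\<forall>i\<ge>1. surj (f i))"

definition feeble_open :: "(nat \<Rightarrow> 'a::topological_space \<Rightarrow> 'a) \<Rightarrow> bool" where
  "feeble_open f \<longleftrightarrow>
     (\<forall>U. open U \<and> U \<noteq> {} \<longrightarrow> (\<forall>i\<ge>1. interior (f i ` U) \<noteq> {}))"

definition transitive_seq :: "(nat \<Rightarrow> 'a::topological_space \<Rightarrow> 'a) \<Rightarrow> bool" where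
  "transitive_seq f \<longleftrightarrow>
     (\<forall>U V. open U \<and> U \<noteq> {} \<and> open V \<and> V \<noteq> {} \<longrightarrow>
        (\<exists>n\<ge>1. iter_from f 1 n ` U \<inter> V \<noteq> {}))"

definition sens_times ::
  "(nat \<Rightarrow> 'a::metric_space \<Rightarrow> 'a) \<Rightarrow> 'a set \<Rightarrow> real \<Rightarrow> nat set" where
  "sens_times f U \<delta> =
     {n. n \<ge> 1 \<and> (\<exists>x\<in>U. \<exists>y\<in>U. dist (iter_from f 1 n x) (iter_from f 1 n y) > \<delta>)}"

definition thick :: "nat set \<Rightarrow> bool" where
  "thick A \<longleftrightarrow> (\<forall>p\<ge>1. \<exists>n\<ge>1. {n..n + p} \<subseteq> A)"

definition thickly_sensitive :: "(nat \<Rightarrow> 'a::metric_space \<Rightarrow> 'a) \<Rightarrow> bool" where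
  "thickly_sensitive f \<longleftrightarrow>
     (\<exists>\<delta>>0. \<forall>U. open U \<and> U \<noteq> {} \<longrightarrow> thick (sens_times f U \<delta>))"

definition multi_sensitive :: "(nat \<Rightarrow> 'a::metric_space \<Rightarrow> 'a) \<Rightarrow> bool" where
  "multi_sensitive f \<longleftrightarrow>
     (\<exists>\<delta>>0. \<forall>m\<ge>1. \<forall>U :: nat \<Rightarrow> 'a set.
        (\<forall>i\<in>{1..m}. open (U i) \<and> U i \<noteq> {}) \<longrightarrow>
        (\<Inter>i\<in>{1..m}. sens_times f (U i) \<delta>) \<noteq> {})"

end

theory Submission
  imports Defs
begin

text \<open>
  Collective convergence makes $f_r^k$ and $f_s^k$ uniformly close, for all $k$ at once, as soon as
  $r$ and $s$ are large. So if an orbit segment of $V$ enters $f_1^r(U)$ at some late time $a$, a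
  sensitivity time $a + k$ of $V$ gives the sensitivity time $r + k$ of $U$, at half the constant.

  Multi-sensitivity, applied to preimages under $f_1^{r+1}, \dots, f_1^{r+p+1}$ of an open set
  inside $f_1^r(U)$, therefore yields a block of consecutive sensitivity times of $U$. Conversely,
  transitivity gives one open set $V$ whose orbit enters every $f_1^r(U_i)$ at some late time
  $a_i$; a long block of sensitivity times of $V$ contains $a_i + n$ for all $i$ and one common $n$.
\<close>

section \<open>Iterates of the system\<close>

lemma iter_from_add:
  "iter_from f i (m + n) = iter_from f (i + m) n \<circ> iter_from f i m"
  by (induction n) (auto simp: add.assoc)

lemma continuous_iter_from:
  assumes "nads f" "i \<ge> 1"
  shows "continuous_on UNIV (iter_from f i n)"
proof (induction n)
  case 0
  show ?case by (simp add: id_def)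
next
  case (Suc n)
  have "continuous_on UNIV (f (i + n))"
    using assms by (simp add: nads_def)
  then have "continuous_on (iter_from f i n ` UNIV) (f (i + n))"
    by (rule continuous_on_subset) simp
  with Suc show ?case
    unfolding iter_from.simps by (rule continuous_on_compose)
qed

lemma open_vimage_iter_from:
  assumes "nads f" "i \<ge> 1" "open W"
  shows "open (iter_from f i n -` W)"
  using open_vimage[OF assms(3) continuous_iter_from[OF assms(1,2)]] .

lemma surj_iter_from:
  assumes "surjective_seq f" "i \<ge> 1"
  shows "surj (iter_from f i n)"
proof (induction n)
  case (Suc n)
  have "surj (f (i + n))"
    using assms by (simp add: surjective_seq_def)
  then show ?case
    unfolding iter_from.simps using Suc by (intro comp_surj)
qed simp

lemma interior_iter_from:
  assumes "feeble_open f" "i \<ge> 1" "open U" "U \<noteq> {}"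
  shows "interior (iter_from f i n ` U) \<noteq> {}"
proof (induction n)
  case 0
  show ?case using assms(3,4) by (simp add: interior_open)
next
  case (Suc n)
  \<comment> \<open>The image itself need not be open, so feeble openness is applied to its
    interior.\<close>
  let ?V = "interior (iter_from f i n ` U)"
  have "interior (f (i + n) ` ?V) \<noteq> {}"
    using assms(1,2) Suc by (simp add: feeble_open_def)
  moreover have "f (i + n) ` ?V \<subseteq> iter_from f i (Suc n) ` U"
    using interior_subset[of "iter_from f i n ` U"] by (auto simp: image_comp[symmetric])
  ultimately show ?case
    using interior_mono by blast
qed

section \<open>Comparison of late iterates\<close>

text \<open>Compactness bounds the distances; without a bound the real \<open>SUP\<close> would say
  nothing about them.\<close>

lemma dist_le_sup_dist:
  fixes g h :: "'a::metric_space \<Rightarrow> 'a"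
  assumes "compact (UNIV :: 'a set)"
  shows "dist (g x) (h x) \<le> sup_dist g h"
  unfolding sup_dist_def
proof (rule cSUP_upper)
  have "dist (g y) (h y) \<le> diameter (UNIV :: 'a set)" for y
    using diameter_bounded_bound[OF compact_imp_bounded[OF assms]] by simp
  then show "bdd_above (range (\<lambda>x. dist (g x) (h x)))"
    by (auto simp: bdd_above_def)
qed simp

text \<open>Both iterates lie within \<open>\<epsilon> / 2\<close> of \<open>g ^^ k\<close>. This
  eliminates \<open>g\<close> and keeps \<open>r\<close> independent of \<open>k\<close>.\<close>

lemma collectively_close:
  assumes "nads f" "converges_collectively f g" "\<epsilon> > 0"
  obtains r where
    "\<forall>s\<ge>r. \<forall>t\<ge>r. \<forall>k\<ge>1. \<forall>x. dist (iter_from f s k x) (iter_from f t k x) < \<epsilon>"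
proof -
  obtain r where r: "\<And>s k. s \<ge> r \<Longrightarrow> k \<ge> 1 \<Longrightarrow> sup_dist (iter_from f s k) (g ^^ k) < \<epsilon> / 2"
    using assms(2,3) unfolding converges_collectively_def by (metis half_gt_zero)
  have "dist (iter_from f s k x) ((g ^^ k) x) < \<epsilon> / 2" if "s \<ge> r" "k \<ge> 1" for s k x
    using dist_le_sup_dist[of "iter_from f s k" x "g ^^ k"] r[OF that] assms(1)
    by (simp add: nads_def)
  then show ?thesis
    by (intro that[of r]) (metis dist_triangle_half_l)
qed

text \<open>Two separated points of \<open>V\<close> are matched with points of \<open>U\<close>
  that have the same images at times \<open>a\<close> and \<open>r\<close>. The remaining
  \<open>k\<close> maps differ by less than \<open>\<delta> / 4\<close> at each of the two images,
  so more than \<open>\<delta> / 2\<close> of the separation survives.\<close>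

lemma sens_times_transfer:
  assumes close: "\<forall>s\<ge>r. \<forall>t\<ge>r. \<forall>k\<ge>1. \<forall>x.
      dist (iter_from f s k x) (iter_from f t k x) < \<delta> / 4"
    and "a \<ge> r" "k \<ge> 1"
    and sub: "iter_from f 1 a ` V \<subseteq> iter_from f 1 r ` U"
    and "a + k \<in> sens_times f V \<delta>"
  shows "r + k \<in> sens_times f U (\<delta> / 2)"
proof -
  obtain x y where xy: "x \<in> V" "y \<in> V"
    and far: "dist (iter_from f 1 (a + k) x) (iter_from f 1 (a + k) y) > \<delta>"
    using assms(5) by (auto simp: sens_times_def)
  obtain u v where uv: "u \<in> U" "v \<in> U" "iter_from f 1 r u = iter_from f 1 a x"
      "iter_from f 1 r v = iter_from f 1 a y"
    using sub xy by (smt (verit) image_iff subsetD)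
  have near: "dist (iter_from f 1 (a + k) z) (iter_from f 1 (r + k) w) < \<delta> / 4"
    if "iter_from f 1 r w = iter_from f 1 a z" for z w
    \<comment> \<open>The tails start at \<open>1 + a\<close> and \<open>1 + r\<close>, since the
      maps up to index \<open>a\<close> or \<open>r\<close> have already been applied.\<close>
    using close[THEN spec, of "1 + a", THEN mp, THEN spec, of "1 + r", THEN mp, THEN spec, of k,
        THEN mp, THEN spec, of "iter_from f 1 a z"] assms(2,3) that
    by (simp add: iter_from_add)
  have "dist (iter_from f 1 (r + k) u) (iter_from f 1 (r + k) v) > \<delta> / 2"
    using far near[OF uv(3)] near[OF uv(4)] by metric
  with uv(1,2) assms(3) show ?thesis
    by (auto simp: sens_times_def)
qed

section \<open>From multi-sensitivity to thick sensitivity\<close>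

text \<open>Finitely many iterates are continuous at a single point, so one neighbourhood keeps all
  their images small.\<close>

lemma small_open_set:
  fixes f :: "nat \<Rightarrow> 'a::metric_space \<Rightarrow> 'a"
  assumes "nads f" "\<delta> > 0"
  obtains B where "open B" "B \<noteq> {}" "\<And>n. n \<le> N \<Longrightarrow> n \<notin> sens_times f B \<delta>"
proof -
  fix x :: 'a
  define B where "B = (\<Inter>n\<in>{..N}. iter_from f 1 n -` ball (iter_from f 1 n x) (\<delta> / 2))"
  have "open B"
    unfolding B_def using open_vimage_iter_from[OF assms(1)] by (intro open_INT) auto
  moreover have "x \<in> B"
    using assms(2) by (simp add: B_def)
  moreover have "n \<notin> sens_times f B \<delta>" if "n \<le> N" for n
  proof -
    have "dist (iter_from f 1 n x) (iter_from f 1 n y) < \<delta> / 2" if "y \<in> B" for y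
      using that \<open>n \<le> N\<close> by (auto simp: B_def)
    then have "dist (iter_from f 1 n y) (iter_from f 1 n z) < \<delta>" if "y \<in> B" "z \<in> B" for y z
      using that dist_triangle_half_r by blast
    then show ?thesis
      by (fastforce simp: sens_times_def)
  qed
  ultimately show ?thesis
    using that by blast
qed

lemma multi_sensitive_imp_thickly_sensitive:
  fixes f :: "nat \<Rightarrow> 'a::metric_space \<Rightarrow> 'a"
  assumes "nads f" "feeble_open f" "surjective_seq f" "converges_collectively f g"
    and "multi_sensitive f"
  shows "thickly_sensitive f"
proof -
  obtain \<delta> where "\<delta> > 0 \<and> (\<forall>m\<ge>1. \<forall>U :: nat \<Rightarrow> 'a set. (\<forall>i\<in>{1..m}. open (U i) \<and> U i \<noteq> {}) \<longrightarrow>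
      (\<Inter>i\<in>{1..m}. sens_times f (U i) \<delta>) \<noteq> {})"
    using assms(5) unfolding multi_sensitive_def ..
  then have \<delta>: "\<delta> > 0" and multi: "\<And>m (U :: nat \<Rightarrow> 'a set). m \<ge> 1 \<Longrightarrow>
      \<forall>i\<in>{1..m}. open (U i) \<and> U i \<noteq> {} \<Longrightarrow> (\<Inter>i\<in>{1..m}. sens_times f (U i) \<delta>) \<noteq> {}"
    by simp_all
  have "\<delta> / 4 > 0"
    using \<delta> by simp
  then obtain r where close: "\<forall>s\<ge>r. \<forall>t\<ge>r. \<forall>k\<ge>1. \<forall>x.
      dist (iter_from f s k x) (iter_from f t k x) < \<delta> / 4"
    by (rule collectively_close[OF assms(1,4)])
  have "\<exists>n\<ge>1. {n..n + p} \<subseteq> sens_times f U (\<delta> / 2)" if U: "open U" "U \<noteq> {}" for U p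
  proof -
    let ?W = "interior (iter_from f 1 r ` U)"
    \<comment> \<open>\<open>B\<close> is an extra member of the family; it forces the common time to exceed \<open>r + Suc p\<close>.\<close>
    obtain B where B: "open B" "B \<noteq> {}" "\<And>n. n \<le> r + Suc p \<Longrightarrow> n \<notin> sens_times f B \<delta>"
      using small_open_set[OF assms(1) \<delta>, of "r + Suc p"] by blast
    \<comment> \<open>For \<open>i \<le> p + 1\<close> the set \<open>V i\<close> enters
      \<open>?W\<close> at time \<open>r + i\<close>, so a common time \<open>n\<close> transfers to
      the time \<open>n - i\<close> for \<open>U\<close>. Running through these \<open>i\<close>
      gives \<open>p + 1\<close> consecutive times.\<close>
    define V where "V i = (if i = p + 2 then B else iter_from f 1 (r + i) -` ?W)" for i
    have "iter_from f 1 n -` ?W \<noteq> {}" for n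
      using surj_iter_from[OF assms(3), of 1 n] interior_iter_from[OF assms(2) _ U, of 1 r]
      by (simp add: surj_vimage_empty)
    then have "\<forall>i\<in>{1..p + 2}. open (V i) \<and> V i \<noteq> {}"
      using B(1,2) open_vimage_iter_from[OF assms(1)] by (auto simp: V_def)
    from multi[OF _ this] obtain n where n: "\<And>i. i \<in> {1..p + 2} \<Longrightarrow> n \<in> sens_times f (V i) \<delta>"
      by fastforce
    \<comment> \<open>Hence \<open>n - r - i \<ge> 1\<close> for every \<open>i \<le> Suc p\<close>,
      as the transfer requires of its \<open>k\<close>.\<close>
    have large: "n > r + Suc p"
      using B(3)[of n] n[of "p + 2"] by (simp add: V_def flip: not_le) blast
    have block: "n - i \<in> sens_times f U (\<delta> / 2)" if i: "1 \<le> i" "i \<le> Suc p" for i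
    proof -
      have "r + (n - r - i) \<in> sens_times f U (\<delta> / 2)"
      proof (rule sens_times_transfer[OF close])
        show "iter_from f 1 (r + i) ` V i \<subseteq> iter_from f 1 r ` U"
          using i interior_subset[of "iter_from f 1 r ` U"] by (auto simp: V_def)
        show "r + i + (n - r - i) \<in> sens_times f (V i) \<delta>"
          using n[of i] i large by auto
      qed (use i large in auto)
      then show ?thesis
        using i large by simp
    qed
    have "j \<in> sens_times f U (\<delta> / 2)" if "n - Suc p \<le> j" "j \<le> n - Suc p + p" for j
      using that large block[of "n - j"] by simp
    then show ?thesis
      using large by (intro exI[of _ "n - Suc p"]) auto
  qed
  then show ?thesis
    unfolding thickly_sensitive_def thick_def using \<delta> by (intro exI[of _ "\<delta> / 2"]) simp
qed

section \<open>From thick sensitivity and transitivity to multi-sensitivity\<close>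

text \<open>A single point is never separated from itself. The absence of isolated points is what
  makes late hitting times available.\<close>

lemma thickly_sensitive_not_open_singleton:
  fixes f :: "nat \<Rightarrow> 'a::metric_space \<Rightarrow> 'a"
  assumes "thickly_sensitive f"
  shows "\<not> open {x :: 'a}"
proof
  assume "open {x}"
  then obtain \<delta> where "\<delta> > 0" "thick (sens_times f {x} \<delta>)"
    using assms unfolding thickly_sensitive_def by blast
  moreover from this(1) have "sens_times f {x} \<delta> = {}"
    by (auto simp: sens_times_def)
  ultimately show False
    by (auto simp: thick_def)
qed

text \<open>Otherwise \<open>W\<close> is finite, and removing all but one of its points, a closed
  set, leaves an isolated point.\<close>

lemma open_Diff_finite_nonempty:
  fixes W :: "'a::t1_space set"
  assumes "\<And>x :: 'a. \<not> open {x}" "open W" "W \<noteq> {}" "finite F"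
  shows "W - F \<noteq> {}"
proof
  assume "W - F = {}"
  then have fin: "finite W"
    using assms(4) finite_subset by auto
  obtain w where "w \<in> W"
    using assms(3) by blast
  then have "{w} = W - (W - {w})"
    by blast
  moreover have "open (W - (W - {w}))"
    using assms(2) fin by (intro open_Diff finite_imp_closed) auto
  ultimately show False
    using assms(1)[of w] by simp
qed

text \<open>
  Transitivity alone gives some $n \ge 1$. Without isolated points, $V$ and $W$ can be shrunk so
  that none of the times up to $N$ works.
\<close>

lemma transitive_late_time:
  fixes f :: "nat \<Rightarrow> 'a::metric_space \<Rightarrow> 'a"
  assumes "nads f" "transitive_seq f" "\<And>x :: 'a. \<not> open {x}"
    and V: "open V" "V \<noteq> {}" and W: "open W" "W \<noteq> {}"
  obtains n where "n \<ge> N" "iter_from f 1 n ` V \<inter> W \<noteq> {}"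
proof -
  obtain x where "x \<in> V"
    using V by blast
  let ?F = "(\<lambda>n. iter_from f 1 n x) ` {..N}"
  obtain w where w: "w \<in> W - ?F"
    using open_Diff_finite_nonempty[OF assms(3) W, of ?F] by blast
  obtain e where e: "e > 0" "\<And>n. n \<le> N \<Longrightarrow> e \<le> dist w (iter_from f 1 n x)"
    using finite_set_avoid[of ?F w] w by (metis (no_types, lifting) DiffE atMost_iff finite_atMost
        finite_imageI imageI)
  \<comment> \<open>Through time \<open>N\<close>, orbits from \<open>V'\<close> stay within
    \<open>e / 2\<close> of the orbit of \<open>x\<close>, which keeps distance at least
    \<open>e\<close> from \<open>w\<close>. They therefore miss \<open>ball w (e / 2)\<close> until
    after \<open>N\<close>.\<close>
  define V' where "V' = V \<inter> (\<Inter>n\<in>{..N}. iter_from f 1 n -` ball (iter_from f 1 n x) (e / 2))"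
  have "open V'"
    unfolding V'_def using open_vimage_iter_from[OF assms(1)] V by (intro open_Int open_INT) auto
  moreover have "x \<in> V'"
    using \<open>x \<in> V\<close> e(1) by (simp add: V'_def)
  moreover have "open (W \<inter> ball w (e / 2))" "w \<in> W \<inter> ball w (e / 2)"
    using W w e(1) by auto
  ultimately obtain n where n: "iter_from f 1 n ` V' \<inter> (W \<inter> ball w (e / 2)) \<noteq> {}"
    using assms(2) unfolding transitive_seq_def by blast
  then obtain y where y: "y \<in> V'" "iter_from f 1 n y \<in> W" "dist w (iter_from f 1 n y) < e / 2"
    by auto
  have "n \<ge> N"
  proof (rule ccontr)
    assume "\<not> n \<ge> N"
    then have "dist (iter_from f 1 n x) (iter_from f 1 n y) < e / 2" "n \<le> N"
      using y(1) by (auto simp: V'_def)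
    with y(3) e(2)[of n] show False
      by metric
  qed
  moreover have "y \<in> V"
    using y(1) by (simp add: V'_def)
  ultimately show ?thesis
    using that y(2) by blast
qed

text \<open>Each new target shrinks \<open>V\<close> to the points that hit it at one late time; the
  inclusions already obtained survive shrinking.\<close>

lemma transitive_simultaneous_hits:
  fixes f :: "nat \<Rightarrow> 'a::metric_space \<Rightarrow> 'a"
  assumes "nads f" "transitive_seq f" "\<And>x :: 'a. \<not> open {x}"
    and "finite I" "\<And>i. i \<in> I \<Longrightarrow> open (W i) \<and> W i \<noteq> {}"
  shows "\<exists>V. open V \<and> V \<noteq> {} \<and> (\<forall>i\<in>I. \<exists>a\<ge>r. iter_from f 1 a ` V \<subseteq> W i)"
  using assms(4,5)
proof (induction I)
  case empty
  show ?case by (intro exI[of _ UNIV]) auto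
next
  case (insert j I)
  obtain V where V: "open V" "V \<noteq> {}" "\<forall>i\<in>I. \<exists>a\<ge>r. iter_from f 1 a ` V \<subseteq> W i"
    using insert.IH insert.prems by (metis insertI2)
  have W: "open (W j)" "W j \<noteq> {}"
    using insert.prems by auto
  obtain n where n: "n \<ge> r" "iter_from f 1 n ` V \<inter> W j \<noteq> {}"
    using transitive_late_time[OF assms(1-3) V(1,2) W] by blast
  let ?V = "V \<inter> iter_from f 1 n -` W j"
  have "open ?V"
    using V(1) open_vimage_iter_from[OF assms(1) _ W(1), of 1 n] by auto
  moreover have "?V \<noteq> {}"
    using n(2) by auto
  moreover have "\<exists>a\<ge>r. iter_from f 1 a ` ?V \<subseteq> W i" if "i \<in> insert j I" for i
  proof (cases "i = j")
    case True
    then show ?thesis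
      using n(1) by auto
  next
    case False
    then show ?thesis
      using V(3) that by blast
  qed
  ultimately show ?case
    by blast
qed

lemma thickly_sensitive_transitive_imp_multi_sensitive:
  fixes f :: "nat \<Rightarrow> 'a::metric_space \<Rightarrow> 'a"
  assumes "nads f" "feeble_open f" "converges_collectively f g"
    and "thickly_sensitive f" "transitive_seq f"
  shows "multi_sensitive f"
proof -
  obtain \<delta> where \<delta>: "\<delta> > 0"
    and thick: "\<And>U. open U \<Longrightarrow> U \<noteq> {} \<Longrightarrow> thick (sens_times f U \<delta>)"
    using assms(4) unfolding thickly_sensitive_def by blast
  have "\<delta> / 4 > 0"
    using \<delta> by simp
  then obtain r where close: "\<forall>s\<ge>r. \<forall>t\<ge>r. \<forall>k\<ge>1. \<forall>x.
      dist (iter_from f s k x) (iter_from f t k x) < \<delta> / 4"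
    by (rule collectively_close[OF assms(1,3)])
  have "(\<Inter>i\<in>{1..m}. sens_times f (U i) (\<delta> / 2)) \<noteq> {}"
    if U: "\<forall>i\<in>{1..m}. open (U i) \<and> U i \<noteq> {}" for m and U :: "nat \<Rightarrow> 'a set"
  proof -
    let ?W = "\<lambda>i. interior (iter_from f 1 r ` U i)"
    have "open (?W i) \<and> ?W i \<noteq> {}" if "i \<in> {1..m}" for i
      using interior_iter_from[OF assms(2)] U that by auto
    then obtain V where V: "open V" "V \<noteq> {}"
      and "\<forall>i\<in>{1..m}. \<exists>a\<ge>r. iter_from f 1 a ` V \<subseteq> ?W i"
      using transitive_simultaneous_hits[OF assms(1,5)
          thickly_sensitive_not_open_singleton[OF assms(4)], of "{1..m}" ?W r] by auto
    then obtain a where a: "\<And>i. i \<in> {1..m} \<Longrightarrow> a i \<ge> r \<and> iter_from f 1 (a i) ` V \<subseteq> ?W i"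
      by metis
    \<comment> \<open>The sum dominates every \<open>a i\<close>, so the block contains all
      \<open>a i + n\<close>; \<open>Suc\<close> ensures the positive length parameter that
      \<open>thick\<close> asks for.\<close>
    obtain n where n: "n \<ge> 1" "{n..n + Suc (\<Sum>i\<in>{1..m}. a i)} \<subseteq> sens_times f V \<delta>"
      using thick[OF V] unfolding thick_def by (metis One_nat_def Suc_le_mono zero_le)
    have "r + n \<in> sens_times f (U i) (\<delta> / 2)" if i: "i \<in> {1..m}" for i
    proof (rule sens_times_transfer[OF close])
      show "iter_from f 1 (a i) ` V \<subseteq> iter_from f 1 r ` U i"
        using a[OF i] interior_subset by blast
      have "a i \<le> (\<Sum>i\<in>{1..m}. a i)"
        using i by (intro member_le_sum) auto
      then show "a i + n \<in> sens_times f V \<delta>"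
        using n(2) by auto
    qed (use a[OF i] n(1) in auto)
    then show ?thesis
      by blast
  qed
  then show ?thesis
    unfolding multi_sensitive_def using \<delta> by (intro exI[of _ "\<delta> / 2"]) simp
qed

theorem theorem16:
  fixes f :: "nat \<Rightarrow> 'a::metric_space \<Rightarrow> 'a" and g :: "'a \<Rightarrow> 'a"
  assumes "nads f"
    and "feeble_open f"
    and "surjective_seq f"
    and "converges_uniformly f g"
    and "converges_collectively f g"
  shows "(multi_sensitive f \<longrightarrow> thickly_sensitive f) \<and>
         (thickly_sensitive f \<and> transitive_seq f \<longrightarrow> multi_sensitive f)"
  using multi_sensitive_imp_thickly_sensitive[OF assms(1,2,3,5)]
    thickly_sensitive_transitive_imp_multi_sensitive[OF assms(1,2,5)] by blast

end
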